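(* Let $I=(\mathcal{E},D,c,f)$ be a CMP instance and let $e\in\mathcal{E}$ be arbitrary. Then: (a) If $e\in\bigcap_{S^*\in D^*}S^*$ (i.e., $e$ lies in every optimal solution), then $l'_I(e)\in\{0,\infty\}$, and if $f$ is of type sum or product, then $l'_I(e)=0$. (b) If $f$ is of type sum, then $l'_I(e)=f(D^+(e))-f(I)$. (c) If $f$ is of type product, then $l'_I(e)=\frac{f(D^+(e))-f(I)}{f(D^+(e))}\cdot c(e)$. (d) If $f$ is of type bottleneck, then, with $c^*:=f(I)$, $$l'_I(e)=\begin{cases} c(e)-c^*, & \text{if } g(e)<c^*,\\ \infty, & \text{otherwise,}\end{cases}$$ where $g(e)=\min_{S\in D^+(e)}\max_{a\in S\setminus\{e\}}c(a)$ if $D^+(e)\neq\emptyset$ and $g(e)=\infty$ if $D^+(e)=\emptyset$.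
   Context: A combinatorial minimization problem (CMP) instance is $I=(\mathcal{E},D,c,f)$ where $\mathcal{E}$ is a finite ground set, $D\subseteq 2^{\mathcal{E}}\setminus\{\emptyset\}$ is a nonempty set of feasible solutions, $c:\mathcal{E}\to\mathbb{R}$ is a cost function, and $f:D\to\mathbb{R}$ is of one of three types: sum, $f(S)=\sum_{a\in S}c(a)$; product, $f(S)=\prod_{a\in S}c(a)$, where for this type all costs are positive; bottleneck, $f(S)=\max_{a\in S}c(a)$. An optimal solution is an $S^*\in D$ minimizing $f$; $D^*$ is the set of optimal solutions and $f(I)$ the optimal value. For $M\subseteq D$, $f(M)=\min_{S\in M}f(S)$, and $f(\emptyset)=\infty$. $D^+(e)=\{S\in D\mid e\in S\}$. For $\alpha\in\mathbb{R}$, $I_{-\alpha,e}$ is the instance with cost of $e$ replaced by $c(e)-\alpha$, other costs unchanged, and objective $f_{-\alpha,e}$ of the same type computed with these costs; $f_{-\alpha,e}(I_{-\alpha,e})$ is its optimal value. Let $\mathrm{maxdec}(e)=\infty$ if $f$ is of type sum or bottleneck and $\mathrm{maxdec}(e)=c(e)$ if of type product. The (new) single lower tolerance is $l'_I(e)=\sup\{\alpha\mid 0\le\alpha<\mathrm{maxdec}(e),\ f_{-\alpha,e}(I_{-\alpha,e})=f(I)\}$ (equivalently $\inf\{\alpha\mid 0\le\alpha<\mathrm{maxdec}(e),\ f_{-\alpha,e}(I_{-\alpha,e})<f(I)\}$), with values in $\mathbb{R}\cup\{\infty\}$, $\sup$ of an unbounded set and $\inf\emptyset$ being $\infty$.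
   Formalization: The sup definition of l' is used. In (c), if no feasible solution contains e, the undefined quotient (∞ − f(I))/∞ is read as 1, giving l'(e) = c(e) (the inf form would give ∞). In (d), the maximum over the empty set S∖{e} is read as −∞. *)

theory Defs
  imports Complex_Main "HOL-Library.Extended_Real"
begin

datatype objective_type = Sum_Type | Product_Type | Bottleneck_Type

text \<open>The objective function of an instance is not a separate component: it is determined by its
  type and the costs.\<close>

record 'a cmp =
  ground :: "'a set"
  feasible :: "'a set set"
  cost :: "'a \<Rightarrow> real"
  obj_type :: objective_type

definition cmp_instance :: "'a cmp \<Rightarrow> bool" where
  "cmp_instance I \<longleftrightarrow>
     finite (ground I) \<and>
     feasible I \<subseteq> Pow (ground I) - {{}} \<and>
     feasible I \<noteq> {} \<and>
     (obj_type I = Product_Type \<longrightarrow> (\<forall>a\<in>ground I. 0 < cost I a))"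

definition objective :: "'a cmp \<Rightarrow> 'a set \<Rightarrow> real" where
  "objective I S =
     (case obj_type I of
        Sum_Type \<Rightarrow> (\<Sum>a\<in>S. cost I a)
      | Product_Type \<Rightarrow> (\<Prod>a\<in>S. cost I a)
      | Bottleneck_Type \<Rightarrow> Max (cost I ` S))"

definition optimal_solutions :: "'a cmp \<Rightarrow> 'a set set" where
  "optimal_solutions I = {S \<in> feasible I. \<forall>T\<in>feasible I. objective I S \<le> objective I T}"

definition optimal_value :: "'a cmp \<Rightarrow> real" where
  "optimal_value I = Min (objective I ` feasible I)"

definition min_objective :: "'a cmp \<Rightarrow> 'a set set \<Rightarrow> ereal" where
  "min_objective I M = (if M = {} then \<infinity> else ereal (Min (objective I ` M)))"

definition feasible_with :: "'a cmp \<Rightarrow> 'a \<Rightarrow> 'a set set" where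
  "feasible_with I e = {S \<in> feasible I. e \<in> S}"

definition decrease_cost :: "'a cmp \<Rightarrow> real \<Rightarrow> 'a \<Rightarrow> 'a cmp" where
  "decrease_cost I \<alpha> e = I\<lparr>cost := (cost I)(e := cost I e - \<alpha>)\<rparr>"

definition maxdec :: "'a cmp \<Rightarrow> 'a \<Rightarrow> ereal" where
  "maxdec I e = (if obj_type I = Product_Type then ereal (cost I e) else \<infinity>)"

definition lower_tolerance :: "'a cmp \<Rightarrow> 'a \<Rightarrow> ereal" where
  "lower_tolerance I e =
     Sup {ereal \<alpha> | \<alpha>. 0 \<le> \<alpha> \<and> ereal \<alpha> < maxdec I e \<and>
                       optimal_value (decrease_cost I \<alpha> e) = optimal_value I}"

text \<open>The quotient $(x - y) / x$, read at $x = \infty$ as its limit $1$. Plain \<^typ>\<open>ereal\<close> arithmetic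
  would give $\infty / \infty = 0$ there.\<close>

definition excess_ratio :: "ereal \<Rightarrow> real \<Rightarrow> ereal" where
  "excess_ratio x y = (if x = \<infinity> then 1 else (x - ereal y) / x)"

text \<open>For the feasible solution \<open>S = {e}\<close> the inner maximum is over the empty set; it is
  $-\infty$, as given by the supremum in \<^typ>\<open>ereal\<close>.\<close>

definition bottleneck_without :: "'a cmp \<Rightarrow> 'a \<Rightarrow> ereal" where
  "bottleneck_without I e =
     (if feasible_with I e = {} then \<infinity>
      else Min ((\<lambda>S. SUP a\<in>S - {e}. ereal (cost I a)) ` feasible_with I e))"

end

theory Submission
  imports Defs
begin

text \<open>Decreasing the cost of \<open>e\<close> leaves solutions avoiding \<open>e\<close> untouched and only makes the other
  ones cheaper. Hence the optimal value survives a decrease by \<open>\<alpha>\<close> iff no solution containing \<open>e\<close>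
  drops below it. For the three objective types the decreased value of \<open>S \<ni> e\<close> is
  $f(S) - \alpha$, $f(S)\,(c(e) - \alpha)/c(e)$ and
  $\max(c(e) - \alpha, \max_{a \in S \setminus \{e\}} c(a))$, so that the admissible \<open>\<alpha>\<close> form an
  explicit interval whose supremum can be read off.\<close>

section \<open>Suprema of real intervals in the extended reals\<close>

lemma Sup_ereal_Icc:
  fixes a b :: real
  assumes "a \<le> b"
  shows "Sup {ereal x | x. a \<le> x \<and> x \<le> b} = ereal b"
  using assms by (intro Sup_eqI) auto

lemma Sup_ereal_Ici: "Sup {ereal x | x. a \<le> x} = \<infinity>"
proof (rule ereal_top)
  fix B :: real
  \<comment> \<open>\<open>max a B\<close> lies in the set and is at least \<open>B\<close>, so
    every real bound is met.\<close>
  have "ereal (max a B) \<le> Sup {ereal x | x. a \<le> x}"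
    by (rule Sup_upper) (blast intro: max.cobounded1)
  then show "ereal B \<le> Sup {ereal x | x. a \<le> x}"
    by (rule order_trans[rotated]) simp
qed

lemma Sup_ereal_Ico:
  fixes a b :: real
  assumes "a < b"
  shows "Sup {ereal x | x. a \<le> x \<and> x < b} = ereal b"
proof (rule Sup_eqI)
  fix y assume y: "\<And>z. z \<in> {ereal x | x. a \<le> x \<and> x < b} \<Longrightarrow> z \<le> y"
  show "ereal b \<le> y"
  \<comment> \<open>By density it is enough to treat \<open>w\<close> strictly between
    \<open>a\<close> and \<open>b\<close>; such a \<open>w\<close> is finite, hence itself a member
    of the set.\<close>
  proof (rule dense_le_bounded[of "ereal a"])
    show "ereal a < ereal b" using assms by simp
    fix w assume "ereal a < w" "w < ereal b"
    then show "w \<le> y" by (cases w) (auto intro: y)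
  qed
qed auto

section \<open>Finiteness, and attainment of the optimal value\<close>

lemma cmp_instance_finite_feasible:
  assumes "cmp_instance I"
  shows "finite (feasible I)"
  using assms finite_subset[of "feasible I" "Pow (ground I)"]
  unfolding cmp_instance_def by auto

lemma cmp_instance_finite_feasible_with:
  assumes "cmp_instance I"
  shows "finite (feasible_with I e)"
  using cmp_instance_finite_feasible[OF assms] unfolding feasible_with_def by simp

lemma cmp_instance_finite_solution:
  assumes "cmp_instance I" and "S \<in> feasible I"
  shows "finite S"
  using assms finite_subset[of S "ground I"] unfolding cmp_instance_def by auto

lemma optimal_value_le_objective:
  assumes "cmp_instance I" and "S \<in> feasible I"
  shows "optimal_value I \<le> objective I S"
  using assms(2) cmp_instance_finite_feasible[OF assms(1)] unfolding optimal_value_def by simp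

lemma optimal_value_attained:
  assumes "cmp_instance I"
  obtains S where "S \<in> optimal_solutions I" "objective I S = optimal_value I"
proof -
  have "optimal_value I \<in> objective I ` feasible I"
    using assms cmp_instance_finite_feasible[OF assms]
    unfolding optimal_value_def cmp_instance_def by (intro Min_in) auto
  then obtain S where S: "S \<in> feasible I" "objective I S = optimal_value I" by auto
  then have "S \<in> optimal_solutions I"
    using optimal_value_le_objective[OF assms] unfolding optimal_solutions_def by auto
  then show thesis using S that by blast
qed

section \<open>Effect of lowering one cost on each objective\<close>

lemma feasible_decrease_cost [simp]: "feasible (decrease_cost I \<alpha> e) = feasible I"
  by (simp add: decrease_cost_def)

lemma obj_type_decrease_cost [simp]: "obj_type (decrease_cost I \<alpha> e) = obj_type I"
  by (simp add: decrease_cost_def)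

lemma ground_decrease_cost [simp]: "ground (decrease_cost I \<alpha> e) = ground I"
  by (simp add: decrease_cost_def)

lemma cost_decrease_cost [simp]:
  "cost (decrease_cost I \<alpha> e) = (cost I)(e := cost I e - \<alpha>)"
  by (simp add: decrease_cost_def)

text \<open>The bound \<open>maxdec\<close> is what keeps the lowered cost positive for products, so
  facts about instances carry over to the modified one.\<close>

lemma cmp_instance_decrease_cost:
  assumes "cmp_instance I" and "ereal \<alpha> < maxdec I e"
  shows "cmp_instance (decrease_cost I \<alpha> e)"
  using assms unfolding cmp_instance_def maxdec_def by auto

lemma objective_decrease_cost_notin:
  assumes "e \<notin> S"
  shows "objective (decrease_cost I \<alpha> e) S = objective I S"
proof -
  have "(cost I)(e := cost I e - \<alpha>) ` S = cost I ` S"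
    using assms by (intro image_cong) auto
  moreover have "sum ((cost I)(e := cost I e - \<alpha>)) S = sum (cost I) S"
    using assms by (intro sum.cong) auto
  moreover have "prod ((cost I)(e := cost I e - \<alpha>)) S = prod (cost I) S"
    using assms by (intro prod.cong) auto
  ultimately show ?thesis
    unfolding objective_def by (simp split: objective_type.split)
qed

lemma objective_decrease_cost_sum:
  assumes "obj_type I = Sum_Type" and "finite S" and "e \<in> S"
  shows "objective (decrease_cost I \<alpha> e) S = objective I S - \<alpha>"
proof -
  have "sum ((cost I)(e := cost I e - \<alpha>)) (S - {e}) = sum (cost I) (S - {e})"
    by (intro sum.cong) auto
  then show ?thesis
    using assms by (simp add: objective_def sum.remove[of S e])
qed

lemma objective_decrease_cost_prod:
  assumes "obj_type I = Product_Type" and "finite S" and "e \<in> S" and "cost I e \<noteq> 0"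
  shows "objective (decrease_cost I \<alpha> e) S = objective I S * (cost I e - \<alpha>) / cost I e"
proof -
  have "prod ((cost I)(e := cost I e - \<alpha>)) (S - {e}) = prod (cost I) (S - {e})"
    by (intro prod.cong) auto
  then show ?thesis
    using assms by (simp add: objective_def prod.remove[of S e])
qed

text \<open>Splitting off \<open>e\<close> may leave the empty set. Working in \<open>ereal\<close>
  covers \<open>S = {e}\<close> too: the empty supremum is minus infinity, which is neutral for
  \<open>max\<close>.\<close>

lemma ereal_objective_bottleneck:
  assumes "obj_type I = Bottleneck_Type" and "finite S" and "e \<in> S"
  shows "ereal (objective I S) = max (ereal (cost I e)) (SUP a\<in>S - {e}. ereal (cost I a))"
proof -
  have "ereal (Max (cost I ` S)) = Max (ereal ` cost I ` S)"
    using assms by (intro mono_Max_commute) (auto simp: mono_def)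
  also have "\<dots> = (SUP a\<in>S. ereal (cost I a))"
    using assms by (subst Max_Sup) (auto simp: image_image)
  also have "\<dots> = (SUP a\<in>insert e (S - {e}). ereal (cost I a))"
    using assms by (simp add: insert_absorb)
  also have "\<dots> = max (ereal (cost I e)) (SUP a\<in>S - {e}. ereal (cost I a))"
    by (simp only: SUP_insert sup_max)
  finally show ?thesis using assms by (simp add: objective_def)
qed

lemma ereal_objective_decrease_cost_bottleneck:
  assumes "obj_type I = Bottleneck_Type" and "finite S" and "e \<in> S"
  shows "ereal (objective (decrease_cost I \<alpha> e) S) =
    max (ereal (cost I e - \<alpha>)) (SUP a\<in>S - {e}. ereal (cost I a))"
proof -
  have "(SUP a\<in>S - {e}. ereal (((cost I)(e := cost I e - \<alpha>)) a)) = (SUP a\<in>S - {e}. ereal (cost I a))"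
    by (intro SUP_cong) auto
  then show ?thesis
    using assms by (subst ereal_objective_bottleneck[where e = e]) auto
qed

lemma objective_prod_pos:
  assumes "cmp_instance I" and "obj_type I = Product_Type" and "S \<in> feasible I"
  shows "0 < objective I S"
  using assms unfolding cmp_instance_def objective_def by (auto intro!: prod_pos)

lemma optimal_value_prod_pos:
  assumes "cmp_instance I" and "obj_type I = Product_Type"
  shows "0 < optimal_value I"
  using optimal_value_attained[OF assms(1)] objective_prod_pos[OF assms]
  by (metis (no_types, lifting) mem_Collect_eq optimal_solutions_def)

lemma objective_decrease_cost_le:
  assumes I: "cmp_instance I" and e: "e \<in> ground I" and S: "S \<in> feasible I" and \<alpha>: "0 \<le> \<alpha>"
  shows "objective (decrease_cost I \<alpha> e) S \<le> objective I S"
proof (cases "e \<in> S")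
  case False
  then show ?thesis by (simp add: objective_decrease_cost_notin)
next
  case True
  have fin: "finite S" using cmp_instance_finite_solution[OF I S] .
  show ?thesis
  proof (cases "obj_type I")
    case Sum_Type
    then show ?thesis using objective_decrease_cost_sum[OF _ fin True] \<alpha> by simp
  next
    case Product_Type
    then have "0 < cost I e" using I e unfolding cmp_instance_def by auto
    then show ?thesis
      using objective_decrease_cost_prod[OF Product_Type fin True] \<alpha>
        objective_prod_pos[OF I Product_Type S]
      by (simp add: divide_le_eq)
  next
    case Bottleneck_Type
    have "ereal (cost I e - \<alpha>) \<le> ereal (cost I e)" using \<alpha> by simp
    then have "ereal (objective (decrease_cost I \<alpha> e) S) \<le> ereal (objective I S)"
      unfolding ereal_objective_bottleneck[OF Bottleneck_Type fin True]
        ereal_objective_decrease_cost_bottleneck[OF Bottleneck_Type fin True]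
      by (rule max.mono) simp
    then show ?thesis by simp
  qed
qed

text \<open>The optimum cannot rise, since no objective value does. It can only fall through a
  solution containing \<open>e\<close>, because the others keep values at or above the old
  optimum.\<close>

lemma optimal_value_decrease_cost_eq_iff:
  assumes I: "cmp_instance I" and e: "e \<in> ground I"
    and \<alpha>: "0 \<le> \<alpha>" "ereal \<alpha> < maxdec I e"
  shows "optimal_value (decrease_cost I \<alpha> e) = optimal_value I \<longleftrightarrow>
    (\<forall>S\<in>feasible_with I e. optimal_value I \<le> objective (decrease_cost I \<alpha> e) S)"
    (is "?L \<longleftrightarrow> ?R")
proof
  note I' = cmp_instance_decrease_cost[OF I \<alpha>(2)]
  show ?R if ?L
    using that optimal_value_le_objective[OF I'] by (auto simp: feasible_with_def)
  assume R: ?R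
  show ?L
  proof (rule antisym)
    obtain S where S: "S \<in> feasible I" "objective I S = optimal_value I"
      using optimal_value_attained[OF I] by (auto simp: optimal_solutions_def)
    have "optimal_value (decrease_cost I \<alpha> e) \<le> objective (decrease_cost I \<alpha> e) S"
      using optimal_value_le_objective[OF I'] S by simp
    also have "\<dots> \<le> objective I S" by (rule objective_decrease_cost_le[OF I e S(1) \<alpha>(1)])
    finally show "optimal_value (decrease_cost I \<alpha> e) \<le> optimal_value I" using S by simp
  next
    \<comment> \<open>This \<open>S\<close> is optimal for the modified instance: if it contains
      \<open>e\<close>, the assumption bounds it, otherwise its value is the old one.\<close>
    obtain S where S: "S \<in> feasible I"
      "objective (decrease_cost I \<alpha> e) S = optimal_value (decrease_cost I \<alpha> e)"
      using optimal_value_attained[OF I'] by (auto simp: optimal_solutions_def)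
    have "optimal_value I \<le> objective (decrease_cost I \<alpha> e) S"
      using R S(1) optimal_value_le_objective[OF I S(1)]
      by (cases "e \<in> S") (auto simp: feasible_with_def objective_decrease_cost_notin)
    then show "optimal_value I \<le> optimal_value (decrease_cost I \<alpha> e)" using S by simp
  qed
qed

lemma lower_tolerance_eq:
  assumes "cmp_instance I" and "e \<in> ground I"
  shows "lower_tolerance I e = Sup {ereal \<alpha> | \<alpha>. 0 \<le> \<alpha> \<and> ereal \<alpha> < maxdec I e \<and>
    (\<forall>S\<in>feasible_with I e. optimal_value I \<le> objective (decrease_cost I \<alpha> e) S)}"
  unfolding lower_tolerance_def
  using optimal_value_decrease_cost_eq_iff[OF assms]
  by (intro arg_cong[where f = Sup] Collect_cong) blast

text \<open>Separates the infinite minimum from a real one \<open>m\<close> attained at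
  \<open>S\<close>, so that the formulas below reduce to real arithmetic.\<close>

lemma min_objective_feasible_with_cases:
  assumes I: "cmp_instance I"
  obtains "feasible_with I e = {}" "min_objective I (feasible_with I e) = \<infinity>"
  | m S where "min_objective I (feasible_with I e) = ereal m" "optimal_value I \<le> m"
      "S \<in> feasible_with I e" "objective I S = m" "\<And>T. T \<in> feasible_with I e \<Longrightarrow> m \<le> objective I T"
proof (cases "feasible_with I e = {}")
  case True
  then show thesis using that(1) by (simp add: min_objective_def)
next
  case False
  let ?m = "Min (objective I ` feasible_with I e)"
  have fin: "finite (feasible_with I e)" using cmp_instance_finite_feasible_with[OF I] .
  have "?m \<in> objective I ` feasible_with I e" using fin False by (intro Min_in) auto
  then obtain S where S: "S \<in> feasible_with I e" "objective I S = ?m" by auto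
  show thesis
  proof (rule that(2)[OF _ _ S])
    show "min_objective I (feasible_with I e) = ereal ?m"
      using False by (simp add: min_objective_def)
    show "optimal_value I \<le> ?m"
      using optimal_value_le_objective[OF I] S by (force simp: feasible_with_def)
    show "?m \<le> objective I T" if "T \<in> feasible_with I e" for T
      using that fin by simp
  qed
qed

section \<open>Tolerances for sums and products\<close>

lemma lower_tolerance_sum:
  assumes I: "cmp_instance I" and e: "e \<in> ground I" and ty: "obj_type I = Sum_Type"
  shows "lower_tolerance I e = min_objective I (feasible_with I e) - ereal (optimal_value I)"
  using I
proof (cases rule: min_objective_feasible_with_cases[where e = e])
  case 1
  \<comment> \<open>No solution contains \<open>e\<close>, so every nonnegative \<alpha> is
    admissible, and infinity minus a real is infinity.\<close>
  then show ?thesis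
    using ty by (simp add: lower_tolerance_eq[OF I e] maxdec_def Sup_ereal_Ici)
next
  case (2 m S)
  have obj: "objective (decrease_cost I \<alpha> e) T = objective I T - \<alpha>"
    if "T \<in> feasible_with I e" for \<alpha> T
    using that objective_decrease_cost_sum[OF ty] cmp_instance_finite_solution[OF I]
    by (auto simp: feasible_with_def)
  have "(\<forall>T\<in>feasible_with I e. optimal_value I \<le> objective (decrease_cost I \<alpha> e) T) \<longleftrightarrow>
    \<alpha> \<le> m - optimal_value I" for \<alpha>
    \<comment> \<open>All values shift by the same \<alpha>, so the minimizer \<open>S\<close> gives
      the tightest constraint.\<close>
    using 2(3-5) by (force simp: obj)
  then show ?thesis
    using 2(1,2) ty by (simp add: lower_tolerance_eq[OF I e] maxdec_def Sup_ereal_Icc)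
qed

lemma lower_tolerance_prod:
  assumes I: "cmp_instance I" and e: "e \<in> ground I" and ty: "obj_type I = Product_Type"
  shows "lower_tolerance I e =
    excess_ratio (min_objective I (feasible_with I e)) (optimal_value I) * ereal (cost I e)"
proof -
  have c: "0 < cost I e" using I e ty unfolding cmp_instance_def by auto
  show ?thesis
    using I
  proof (cases rule: min_objective_feasible_with_cases[where e = e])
    case 1
    \<comment> \<open>Here the admissible set is the half-open interval from 0 to
      \<open>cost I e\<close>; its supremum \<open>cost I e\<close> matches the value 1 of
      \<open>excess_ratio\<close> at infinity.\<close>
    then show ?thesis
      using ty c
      by (simp add: lower_tolerance_eq[OF I e] maxdec_def Sup_ereal_Ico excess_ratio_def)
  next
    case (2 m S)
    let ?v = "optimal_value I" and ?c = "cost I e"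
    \<comment> \<open>\<open>?b\<close> is the decrease at which the scaled minimum
      \<open>m * ((?c - \<alpha>) / ?c)\<close> equals \<open>?v\<close>.\<close>
    let ?b = "(m - ?v) / m * ?c"
    have obj: "objective (decrease_cost I \<alpha> e) T = objective I T * ((?c - \<alpha>) / ?c)"
      if "T \<in> feasible_with I e" for \<alpha> T
      using that objective_decrease_cost_prod[OF ty] cmp_instance_finite_solution[OF I] c
      by (auto simp: feasible_with_def)
    have m: "0 < m"
      using objective_prod_pos[OF I ty, of S] 2(3,4) by (simp add: feasible_with_def)
    have v: "0 < ?v" using optimal_value_prod_pos[OF I ty] .
    have min_iff: "(\<forall>T\<in>feasible_with I e. ?v \<le> objective (decrease_cost I \<alpha> e) T) \<longleftrightarrow> \<alpha> \<le> ?b"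
      if "\<alpha> < ?c" for \<alpha>
    proof -
      have "(\<forall>T\<in>feasible_with I e. ?v \<le> objective (decrease_cost I \<alpha> e) T) \<longleftrightarrow>
        ?v \<le> m * ((?c - \<alpha>) / ?c)"
      proof
        assume R: "?v \<le> m * ((?c - \<alpha>) / ?c)"
        \<comment> \<open>For \<alpha> below \<open>?c\<close> the common scaling factor is
          positive, so the order of objective values is preserved.\<close>
        have "m * ((?c - \<alpha>) / ?c) \<le> objective I T * ((?c - \<alpha>) / ?c)"
          if "T \<in> feasible_with I e" for T
          using 2(5)[OF that] \<open>\<alpha> < ?c\<close> c by (intro mult_right_mono) auto
        then show "\<forall>T\<in>feasible_with I e. ?v \<le> objective (decrease_cost I \<alpha> e) T"
          using R by (force simp: obj)
      qed (use 2(3,4) obj in force)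
      also have "\<dots> \<longleftrightarrow> \<alpha> \<le> ?b"
        using m c by (simp add: field_simps)
      finally show ?thesis .
    qed
    \<comment> \<open>The strict bound comes from \<open>0 < ?v\<close>; it makes the
      \<open>maxdec\<close> constraint follow from \<open>\<alpha> \<le> ?b\<close>, leaving a
      closed interval.\<close>
    have b: "0 \<le> ?b" "?b < ?c" using 2(2) m v c by (simp_all add: field_simps)
    have "lower_tolerance I e = Sup {ereal \<alpha> | \<alpha>. 0 \<le> \<alpha> \<and> \<alpha> \<le> ?b}"
      unfolding lower_tolerance_eq[OF I e]
      using min_iff b(2) ty
      by (intro arg_cong[where f = Sup] Collect_cong) (force simp: maxdec_def)
    also have "\<dots> = ereal ?b" by (rule Sup_ereal_Icc[OF b(1)])
    finally show ?thesis using 2(1) m by (simp add: excess_ratio_def)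
  qed
qed

section \<open>Tolerances for bottlenecks\<close>

lemma bottleneck_without_less_iff:
  assumes "cmp_instance I"
  shows "bottleneck_without I e < ereal v \<longleftrightarrow>
    (\<exists>S\<in>feasible_with I e. (SUP a\<in>S - {e}. ereal (cost I a)) < ereal v)"
  using cmp_instance_finite_feasible_with[OF assms, of e]
  by (auto simp: bottleneck_without_def Min_less_iff)

text \<open>Some solution has all its other costs below the optimum, yet its value is not below it,
  so \<open>e\<close> must supply the maximum. This makes the tolerance in the finite case
  nonnegative.\<close>

lemma optimal_value_le_cost_of_bottleneck_without_less:
  assumes I: "cmp_instance I" and ty: "obj_type I = Bottleneck_Type"
    and less: "bottleneck_without I e < ereal (optimal_value I)"
  shows "optimal_value I \<le> cost I e"
proof -
  obtain S where S: "S \<in> feasible I" "e \<in> S"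
    "(SUP a\<in>S - {e}. ereal (cost I a)) < ereal (optimal_value I)"
    using less unfolding bottleneck_without_less_iff[OF I] by (auto simp: feasible_with_def)
  have "ereal (optimal_value I) \<le> ereal (objective I S)"
    using optimal_value_le_objective[OF I S(1)] by simp
  then show ?thesis
    using S(3) ereal_objective_bottleneck[OF ty cmp_instance_finite_solution[OF I S(1)] S(2)]
    by (auto simp: le_max_iff_disj)
qed

lemma lower_tolerance_bottleneck:
  assumes I: "cmp_instance I" and e: "e \<in> ground I" and ty: "obj_type I = Bottleneck_Type"
  shows "lower_tolerance I e =
    (if bottleneck_without I e < ereal (optimal_value I)
     then ereal (cost I e - optimal_value I) else \<infinity>)"
proof -
  let ?v = "optimal_value I" and ?c = "cost I e"
  let ?g = "\<lambda>S. SUP a\<in>S - {e}. ereal (cost I a)"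
  have obj_iff: "?v \<le> objective (decrease_cost I \<alpha> e) S \<longleftrightarrow> \<alpha> \<le> ?c - ?v \<or> ereal ?v \<le> ?g S"
    if "S \<in> feasible_with I e" for \<alpha> S
  proof -
    have "ereal (objective (decrease_cost I \<alpha> e) S) = max (ereal (?c - \<alpha>)) (?g S)"
      using that ereal_objective_decrease_cost_bottleneck[OF ty] cmp_instance_finite_solution[OF I]
      by (auto simp: feasible_with_def)
    then have "ereal ?v \<le> ereal (objective (decrease_cost I \<alpha> e) S) \<longleftrightarrow>
      ereal ?v \<le> ereal (?c - \<alpha>) \<or> ereal ?v \<le> ?g S"
      by (simp only: le_max_iff_disj)
    then show ?thesis by (simp add: algebra_simps)
  qed
  \<comment> \<open>The bound \<open>\<alpha> \<le> ?c - ?v\<close> is the same for all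
    \<open>S\<close>, so it leaves the quantifier; what remains says that \<open>?g S\<close> is at
    least \<open>?v\<close> for every \<open>S\<close>, which is the negated inequality.\<close>
  have tol: "lower_tolerance I e = Sup {ereal \<alpha> | \<alpha>. 0 \<le> \<alpha> \<and>
    (\<alpha> \<le> ?c - ?v \<or> \<not> bottleneck_without I e < ereal ?v)}"
    unfolding lower_tolerance_eq[OF I e] bottleneck_without_less_iff[OF I]
    using obj_iff ty
    by (intro arg_cong[where f = Sup] Collect_cong) (auto simp: maxdec_def not_less)
  show ?thesis
    using optimal_value_le_cost_of_bottleneck_without_less[OF I ty]
    by (simp add: tol Sup_ereal_Icc Sup_ereal_Ici)
qed

section \<open>Elements common to all optimal solutions\<close>

lemma min_objective_feasible_with_eq_optimal_value:
  assumes I: "cmp_instance I" and e: "e \<in> \<Inter> (optimal_solutions I)"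
  shows "min_objective I (feasible_with I e) = ereal (optimal_value I)"
proof -
  obtain S where S: "S \<in> optimal_solutions I" "objective I S = optimal_value I"
    using optimal_value_attained[OF I] .
  \<comment> \<open>Being optimal, \<open>S\<close> contains \<open>e\<close>, so the minimum over
    \<open>feasible_with I e\<close> already reaches the optimum.\<close>
  then have "S \<in> feasible_with I e"
    using e by (auto simp: feasible_with_def optimal_solutions_def)
  with I show ?thesis
    using S(2) by (cases rule: min_objective_feasible_with_cases[where e = e]) force+
qed

lemma cost_le_optimal_value_bottleneck:
  assumes I: "cmp_instance I" and ty: "obj_type I = Bottleneck_Type"
    and e: "e \<in> \<Inter> (optimal_solutions I)"
  shows "cost I e \<le> optimal_value I"
proof -
  obtain S where S: "S \<in> optimal_solutions I" "objective I S = optimal_value I"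
    using optimal_value_attained[OF I] .
  have "e \<in> S" "finite S"
    using S(1) e cmp_instance_finite_solution[OF I] by (auto simp: optimal_solutions_def)
  then show ?thesis
    using S(2) ty Max_ge[of "cost I ` S" "cost I e"] by (simp add: objective_def)
qed

theorem theorem4:
  fixes I :: "'a cmp" and e :: 'a
  assumes "cmp_instance I" and "e \<in> ground I"
  shows
    "(e \<in> \<Inter> (optimal_solutions I) \<longrightarrow>
        lower_tolerance I e \<in> {0, \<infinity>} \<and>
        (obj_type I \<in> {Sum_Type, Product_Type} \<longrightarrow> lower_tolerance I e = 0)) \<and>
     (obj_type I = Sum_Type \<longrightarrow>
        lower_tolerance I e =
          min_objective I (feasible_with I e) - ereal (optimal_value I)) \<and>
     (obj_type I = Product_Type \<longrightarrow>
        lower_tolerance I e =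
          excess_ratio (min_objective I (feasible_with I e)) (optimal_value I)
            * ereal (cost I e)) \<and>
     (obj_type I = Bottleneck_Type \<longrightarrow>
        lower_tolerance I e =
          (if bottleneck_without I e < ereal (optimal_value I)
           then ereal (cost I e - optimal_value I)
           else \<infinity>))"
proof (intro conjI impI)
  assume opt: "e \<in> \<Inter> (optimal_solutions I)"
  note min = min_objective_feasible_with_eq_optimal_value[OF assms(1) opt]
  have "lower_tolerance I e = 0" if "obj_type I = Sum_Type"
    using lower_tolerance_sum[OF assms that] min by simp
  moreover have "lower_tolerance I e = 0" if "obj_type I = Product_Type"
    using lower_tolerance_prod[OF assms that] min optimal_value_prod_pos[OF assms(1) that]
    by (simp add: excess_ratio_def zero_ereal_def)
  ultimately show zero: "obj_type I \<in> {Sum_Type, Product_Type} \<Longrightarrow> lower_tolerance I e = 0"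
    by blast
  show "lower_tolerance I e \<in> {0, \<infinity>}"
  proof (cases "obj_type I = Bottleneck_Type")
    case True
    \<comment> \<open>In the finite case \<open>cost I e\<close> is bounded by the optimum from both
      sides, so the tolerance is 0.\<close>
    then show ?thesis
      using lower_tolerance_bottleneck[OF assms True]
        optimal_value_le_cost_of_bottleneck_without_less[OF assms(1) True, of e]
        cost_le_optimal_value_bottleneck[OF assms(1) True opt]
      by (auto simp: zero_ereal_def)
  next
    case False
    then show ?thesis using zero by (cases "obj_type I") auto
  qed
qed (use lower_tolerance_sum[OF assms] lower_tolerance_prod[OF assms]
      lower_tolerance_bottleneck[OF assms] in blast)+

end
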